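(* Let $P=(p_0,p_1,p_2)$ be a triangular pattern with perimeter $1$ and let $\epsilon>0$. Consider three synchronous robots in the plane, and let $f_i(t)$ denote the position of robot $i$ at time step $t$. At each time step $t$, every robot $i$ ($i\in\{0,1,2\}$, indices modulo $3$) simultaneously does the following with $r_j=f_j(t)$: it computes the point $t_i$ such that $\angle t_i r_{i+1} r_{i-1}=\angle p_i p_{i+1}p_{i-1}$ and $\angle r_{i+1}r_{i-1}t_i=\angle p_{i+1}p_{i-1}p_i$, sets $r=d(r_i,t_i)\,d(p_{i+1},p_{i-1})$, and moves a distance $\min(r,\epsilon)$ along the straight line toward $t_i$, reaching $f_i(t+1)$. Let $Q^t=(q^t_0,q^t_1,q^t_2)$ be the solution computed at time $t$, i.e. $q_i^t$ is the point reached from $f_i(t)$ by moving the full distance $r$ toward $t_i$. Then $Q^t=Q^{t+1}$.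
   Context: $d(\cdot,\cdot)$ is Euclidean distance. A triangular pattern is a sequence of three distinct points. The angles in the algorithm are directed, i.e. $t_i$ is the unique point such that the triple $(t_i,r_{i+1},r_{i-1})$ is obtained from $(p_i,p_{i+1},p_{i-1})$ by a translation, rotation, and/or uniform scaling (no reflection). The solution at a given time is computed from pairwise distinct robot positions, so that the points $t_i$ are well defined. *)

theory Defs
  imports Complex_Main "HOL-Library.Numeral_Type"
begin

text \<open>
  The plane is \<^typ>\<open>complex\<close>. Triples of points are functions on the type \<^typ>\<open>3\<close> of
  integers modulo 3, so \<open>i + 1\<close> and \<open>i - 1\<close> are cyclic index arithmetic, and \<^term>\<open>inj r\<close>
  says that the three points of \<^term>\<open>r\<close> are pairwise distinct. Collinear patterns are allowed.
\<close>

definition triangular_pattern :: "(3 \<Rightarrow> complex) \<Rightarrow> bool" where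
  "triangular_pattern p \<longleftrightarrow> inj p"

definition perimeter :: "(3 \<Rightarrow> complex) \<Rightarrow> real" where
  "perimeter p = dist (p 0) (p 1) + dist (p 1) (p 2) + dist (p 2) (p 0)"

definition direct_similarity :: "(complex \<Rightarrow> complex) \<Rightarrow> bool" where
  "direct_similarity h \<longleftrightarrow>
     (\<exists>s::real. \<exists>\<theta>::real. \<exists>b::complex. s > 0 \<and> h = (\<lambda>z. b + of_real s * (cis \<theta> * z)))"

definition is_target :: "(3 \<Rightarrow> complex) \<Rightarrow> (3 \<Rightarrow> complex) \<Rightarrow> 3 \<Rightarrow> complex \<Rightarrow> bool" where
  "is_target p r i x \<longleftrightarrow>
     (\<exists>h. direct_similarity h \<and>
          h (p i) = x \<and> h (p (i + 1)) = r (i + 1) \<and> h (p (i - 1)) = r (i - 1))"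

text \<open>
  Unspecified when \<open>r (i + 1) = r (i - 1)\<close>; otherwise well defined by
  \<open>is_target_unique\<close> below.
\<close>

definition target :: "(3 \<Rightarrow> complex) \<Rightarrow> (3 \<Rightarrow> complex) \<Rightarrow> 3 \<Rightarrow> complex" where
  "target p r i = (THE x. is_target p r i x)"

definition full_length :: "(3 \<Rightarrow> complex) \<Rightarrow> (3 \<Rightarrow> complex) \<Rightarrow> 3 \<Rightarrow> real" where
  "full_length p r i = dist (r i) (target p r i) * dist (p (i + 1)) (p (i - 1))"

text \<open>
  Since \<open>sgn 0 = 0\<close>, nothing moves when \<open>x = y\<close>; in the algorithm the distance
  \<open>d\<close> is then 0 anyway.
\<close>

definition move_toward :: "complex \<Rightarrow> complex \<Rightarrow> real \<Rightarrow> complex" where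
  "move_toward x y d = x + d *\<^sub>R sgn (y - x)"

definition step :: "(3 \<Rightarrow> complex) \<Rightarrow> real \<Rightarrow> (3 \<Rightarrow> complex) \<Rightarrow> (3 \<Rightarrow> complex)" where
  "step p \<epsilon> r = (\<lambda>i. move_toward (r i) (target p r i) (min (full_length p r i) \<epsilon>))"

definition solution :: "(3 \<Rightarrow> complex) \<Rightarrow> (3 \<Rightarrow> complex) \<Rightarrow> (3 \<Rightarrow> complex)" where
  "solution p r = (\<lambda>i. move_toward (r i) (target p r i) (full_length p r i))"

text \<open>
  Here \<^term>\<open>f t i\<close> is the position of robot \<^term>\<open>i\<close> at time \<^term>\<open>t\<close>. The step is only prescribed
  from pairwise distinct positions, where the targets are well defined.
\<close>

definition execution :: "(3 \<Rightarrow> complex) \<Rightarrow> real \<Rightarrow> (nat \<Rightarrow> 3 \<Rightarrow> complex) \<Rightarrow> bool" where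
  "execution p \<epsilon> f \<longleftrightarrow> (\<forall>t. inj (f t) \<longrightarrow> f (Suc t) = step p \<epsilon> (f t))"

lemma is_target_iff:
  assumes p: "p (i + 1) \<noteq> p (i - 1)" and r: "r (i + 1) \<noteq> r (i - 1)"
  shows "is_target p r i x \<longleftrightarrow>
    x = r (i + 1) + (p i - p (i + 1)) / (p (i - 1) - p (i + 1)) * (r (i - 1) - r (i + 1))"
    (is "_ \<longleftrightarrow> x = ?x")
proof
  assume "is_target p r i x"
  then obtain s \<theta> b where h: "x = b + of_real s * (cis \<theta> * p i)"
    "r (i + 1) = b + of_real s * (cis \<theta> * p (i + 1))"
    "r (i - 1) = b + of_real s * (cis \<theta> * p (i - 1))"
    unfolding is_target_def direct_similarity_def by metis
  show "x = ?x"
    unfolding h using p by (simp add: divide_simps) (simp add: algebra_simps)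
next
  assume x: "x = ?x"
  define a where "a = (r (i - 1) - r (i + 1)) / (p (i - 1) - p (i + 1))"
  define b where "b = r (i + 1) - a * p (i + 1)"
  define h where "h = (\<lambda>z. b + of_real (cmod a) * (cis (Arg a) * z))"
  have "a \<noteq> 0" using p r by (auto simp: a_def)
  have a: "a = of_real (cmod a) * cis (Arg a)"
    by (metis rcis_cmod_Arg rcis_def)
  have h: "h z = b + a * z" for z
    unfolding h_def by (subst (3) a) (simp add: mult.assoc)
  have "direct_similarity h"
    unfolding direct_similarity_def h_def using \<open>a \<noteq> 0\<close> by (metis zero_less_norm_iff)
  moreover have "h (p i) = x"
    unfolding h x b_def a_def using p by (simp add: divide_simps) (simp add: algebra_simps)
  moreover have "h (p (i + 1)) = r (i + 1)" by (simp add: h b_def)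
  moreover have "h (p (i - 1)) = r (i - 1)"
    unfolding h b_def a_def using p by (simp add: divide_simps) (simp add: algebra_simps)
  ultimately show "is_target p r i x" unfolding is_target_def by blast
qed

lemma is_target_unique:
  assumes "p (i + 1) \<noteq> p (i - 1)" and "r (i + 1) \<noteq> r (i - 1)"
  shows "\<exists>!x. is_target p r i x"
  by (simp add: is_target_iff[where p=p and r=r, OF assms])

end

theory Submission
  imports Defs
begin

text \<open>
  The displacement of robot \<open>i\<close> to its target is \<open>W / (p (i - 1) - p (i + 1))\<close>, where the
  numerator \<open>W\<close> does not depend on \<open>i\<close>. Hence all robots have the same full length \<open>cmod W\<close>,
  and a step moves robot \<open>i\<close> by \<open>c * W * u i\<close>, where the real \<open>c\<close> is common to all robots and
  the unit vectors \<open>u i\<close> depend only on the pattern. Since \<open>W\<close> is linear in the positions and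
  the perimeter is 1, the step replaces \<open>W\<close> by \<open>(1 - c) * W\<close>, so that the solution points
  \<open>r i + W * u i\<close> do not change.
\<close>

text \<open>Minus the determinant with rows \<open>1\<close>, \<open>p\<close>, \<open>r\<close>;
  for injective \<open>p\<close> it vanishes iff some map z -> a z + b sends every
  \<open>p i\<close> to \<open>r i\<close>.\<close>

definition discrepancy :: "(3 \<Rightarrow> complex) \<Rightarrow> (3 \<Rightarrow> complex) \<Rightarrow> complex" where
  "discrepancy p r = (\<Sum>i\<in>UNIV. r i * (p (i + 1) - p (i - 1)))"

lemma mod3_neq [simp]: "i \<noteq> i + 1" "i \<noteq> i - 1" "i + 1 \<noteq> i - 1" for i :: 3
proof -
  have "(2 :: 3) \<noteq> 0" by simp
  then show "i \<noteq> i + 1" "i \<noteq> i - 1" "i + 1 \<noteq> i - 1" by (auto simp: algebra_simps)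
qed

lemma UNIV_mod3: "UNIV = {i, i + 1, i - 1 :: 3}"
proof -
  have "card {i, i + 1, i - 1} = CARD(3)" by simp
  then show ?thesis by (intro card_subset_eq[symmetric]) simp_all
qed

lemma sum_mod3: "(\<Sum>j\<in>UNIV. g j) = g i + g (i + 1) + g (i - 1)" for i :: 3
  by (subst UNIV_mod3[of i]) (simp add: add.assoc)

lemma target_diff:
  assumes "inj p" and "inj r"
  shows "target p r i - r i = discrepancy p r / (p (i - 1) - p (i + 1))"
proof -
  have p: "p (i + 1) \<noteq> p (i - 1)" and r: "r (i + 1) \<noteq> r (i - 1)"
    using assms by (simp_all add: inj_eq)
  have idx: "i + 1 + 1 = i - 1" "i - 1 - 1 = i + 1" for i :: 3
    by (simp_all add: algebra_simps)
  have "target p r i =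
      r (i + 1) + (p i - p (i + 1)) / (p (i - 1) - p (i + 1)) * (r (i - 1) - r (i + 1))"
    unfolding target_def is_target_iff[where p=p and r=r, OF p r] by simp
  \<comment> \<open>Starting the cyclic sum at \<open>i\<close> exposes the numerator of
    \<open>target p r i - r i\<close>.\<close>
  moreover have "discrepancy p r = r i * (p (i + 1) - p (i - 1)) +
      r (i + 1) * (p (i - 1) - p i) + r (i - 1) * (p i - p (i + 1))"
    unfolding discrepancy_def sum_mod3[of _ i] by (simp add: idx)
  ultimately show ?thesis
    using p by (simp add: divide_simps) (simp add: algebra_simps)
qed

text \<open>The factor \<open>dist (p (i + 1)) (p (i - 1))\<close> cancels the denominator in
  \<open>target_diff\<close>.\<close>

lemma full_length_eq:
  assumes "inj p" and "inj r"
  shows "full_length p r i = cmod (discrepancy p r)"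
proof -
  have "p (i + 1) \<noteq> p (i - 1)" using assms by (simp add: inj_eq)
  then show ?thesis
    using target_diff[OF assms, of i]
    by (simp add: full_length_def dist_commute[of "r i"] dist_commute[of "p (i + 1)"]
        dist_norm[of "target p r i"] dist_norm[of "p (i - 1)"] norm_divide)
qed

text \<open>\<open>sgn\<close> is multiplicative, so the direction splits into a part common to all
  robots and the unit vector of a pattern side.\<close>

lemma move_toward_target:
  assumes "inj p" and "inj r"
  shows "move_toward (r i) (target p r i) d =
    r i + of_real d * sgn (discrepancy p r) / sgn (p (i - 1) - p (i + 1))"
  unfolding move_toward_def target_diff[OF assms]
  by (simp add: sgn_divide scaleR_conv_of_real)

lemma of_real_norm_mult_sgn: "of_real (cmod z) * sgn z = z"
  by (simp add: sgn_eq)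

lemma solution_eq:
  assumes "inj p" and "inj r"
  shows "solution p r i = r i + discrepancy p r / sgn (p (i - 1) - p (i + 1))"
  by (simp add: solution_def move_toward_target full_length_eq assms of_real_norm_mult_sgn)

text \<open>Robot \<open>i\<close> contributes \<open>- v\<close> times the length of the side
  opposite \<open>p i\<close>, and these lengths add up to 1.\<close>

lemma discrepancy_translate:
  assumes "perimeter p = 1"
  shows "discrepancy p (\<lambda>i. r i + v / sgn (p (i - 1) - p (i + 1))) = discrepancy p r - v"
proof -
  have *: "z / sgn w * - w = - z * of_real (cmod w)" for z w :: complex
    by (cases "w = 0") (simp_all add: sgn_eq)
  have "discrepancy p (\<lambda>i. r i + v / sgn (p (i - 1) - p (i + 1))) =
    discrepancy p r + (\<Sum>i\<in>UNIV. v / sgn (p (i - 1) - p (i + 1)) * - (p (i - 1) - p (i + 1)))"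
    unfolding discrepancy_def sum.distrib[symmetric]
    by (intro sum.cong) (simp_all add: algebra_simps)
  also have "\<dots> = discrepancy p r - v * of_real (\<Sum>i\<in>UNIV. cmod (p (i - 1) - p (i + 1)))"
    unfolding * by (simp add: sum_negf sum_distrib_left)
  also have "(\<Sum>i\<in>UNIV. cmod (p (i - 1) - p (i + 1))) = perimeter p"
  proof -
    have idx: "0 - 1 = (2 :: 3)" "2 - 1 = (1 :: 3)" "2 + 1 = (0 :: 3)"
      by (simp_all add: diff_eq_eq)
    show ?thesis
      unfolding perimeter_def sum_mod3[of _ 0] idx
      by (simp add: idx dist_norm norm_minus_commute)
  qed
  finally show ?thesis using assms by simp
qed

theorem theorem7:
  fixes p :: "3 \<Rightarrow> complex" and \<epsilon> :: real and f :: "nat \<Rightarrow> 3 \<Rightarrow> complex" and t :: nat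
  assumes "triangular_pattern p"
    and "perimeter p = 1"
    and "\<epsilon> > 0"
    and "execution p \<epsilon> f"
    and "inj (f t)"
    and "inj (f (Suc t))"
  shows "solution p (f t) = solution p (f (Suc t))"
proof
  fix i
  have p: "inj p" using assms by (simp add: triangular_pattern_def)
  define W where "W = discrepancy p (f t)"
  \<comment> \<open>Full lengths agree, so \<open>\<epsilon>\<close> cuts off all moves or none, and
    one \<open>v\<close> serves all robots.\<close>
  define v where "v = of_real (min (cmod W) \<epsilon>) * sgn W"
  have step: "f (Suc t) = (\<lambda>i. f t i + v / sgn (p (i - 1) - p (i + 1)))"
    using assms(4,5) p
    by (simp add: execution_def step_def move_toward_target full_length_eq W_def v_def)
  have "discrepancy p (f (Suc t)) = W - v"
    unfolding step W_def using assms(2) by (rule discrepancy_translate)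
  \<comment> \<open>What the positions gain, \<open>v\<close>, the discrepancy loses.\<close>
  then show "solution p (f t) i = solution p (f (Suc t)) i"
    using p assms(5,6) by (simp add: solution_eq step W_def diff_divide_distrib)
qed

end
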